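(* Let $X$ be the Schreier space, let $x\in E(X)$ be an extreme point of its unit ball, and let $F$ be the non-maximal 1-set of $x$. Then $|F|=\frac12|\mathrm{supp}\,x|$. Consequently, for every $x\in E(X)$ the cardinality of $\mathrm{supp}\,x$ is even.
   Context: Schreier space: let $c_{00}$ be the vector space of finitely supported real sequences $x=(x(1),x(2),\ldots)$. A set $F\subset\mathbb{N}=\{1,2,\ldots\}$ is admissible if $\min F\geqslant |F|$, and $\mathcal{S}_1$ denotes the collection of all admissible subsets of $\mathbb{N}$. The Schreier space $X$ is the completion of $c_{00}$ with respect to the norm $\|x\|=\sup_{F\in\mathcal{S}_1}\sum_{i\in F}|x(i)|$. $S(X)$ and $E(X)$ denote the unit sphere and the set of extreme points of the closed unit ball of $X$. The support of $x$ is $\mathrm{supp}\,x=\{i\in\mathbb{N}:x(i)\neq 0\}$. For $x\in S(X)$, a 1-set of $x$ is a set $F\in\mathcal{S}_1$ with $\sum_{i\in F}|x(i)|=1$ and $|x(i)|>0$ for all $i\in F$. A set $F\in\mathcal{S}_1$ is non-maximal if $F\cup\{j\}\in\mathcal{S}_1$ for some $j\notin F$. A non-maximal 1-set of $x$ is a 1-set of $x$ that is non-maximal. Known facts (Shura and Trautman): every $x\in E(X)$ is finitely supported and has a non-maximal 1-set. This non-maximal 1-set is unique, so one speaks of "the non-maximal 1-set of $x$". *)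

theory Defs
  imports "HOL-Analysis.Analysis"
begin

text \<open>
  Sequences \<open>(x(1), x(2), \<dots>)\<close> are functions \<open>x :: nat \<Rightarrow> real\<close> with the dummy value \<open>x 0 = 0\<close>.
  The empty set counts as admissible; infinite sets never are (\<open>card\<close> is 0 on them, hence the
  explicit finiteness).
\<close>

definition admissible :: "nat set \<Rightarrow> bool" where
  "admissible F \<longleftrightarrow> F \<subseteq> {1..} \<and> finite F \<and> (F \<noteq> {} \<longrightarrow> card F \<le> Min F)"

definition c00 :: "(nat \<Rightarrow> real) set" where
  "c00 = {x. x 0 = 0 \<and> finite {i. x i \<noteq> 0}}"

text \<open>
  The completion of \<open>c00\<close> is realised by sequences, namely those approximable by elements of
  \<open>c00\<close> in the Schreier norm (the inner bound says that the norm of \<open>x - y\<close> is at most \<open>e\<close>,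
  without presupposing that the supremum exists). That this is the completion is the
  content of the class instance \<open>banach\<close> and of the lemmas \<open>norm_schreier_eq\<close>,
  \<open>c00_embeds\<close> and \<open>c00_dense\<close> below.
\<close>

definition schreier_seqs :: "(nat \<Rightarrow> real) set" where
  "schreier_seqs = {x. x 0 = 0 \<and>
     (\<forall>e>0. \<exists>y\<in>c00. \<forall>F. admissible F \<longrightarrow> (\<Sum>i\<in>F. \<bar>x i - y i\<bar>) \<le> e)}"

lemma schreier_seqs_approx:
  "x \<in> schreier_seqs \<Longrightarrow> e > 0 \<Longrightarrow>
     \<exists>y\<in>c00. \<forall>F. admissible F \<longrightarrow> (\<Sum>i\<in>F. \<bar>x i - y i\<bar>) \<le> e"
  by (simp add: schreier_seqs_def)

lemma schreier_seqsI:
  "x 0 = 0 \<Longrightarrow>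
     (\<And>e. e > 0 \<Longrightarrow> \<exists>y\<in>c00. \<forall>F. admissible F \<longrightarrow> (\<Sum>i\<in>F. \<bar>x i - y i\<bar>) \<le> e) \<Longrightarrow>
     x \<in> schreier_seqs"
  by (simp add: schreier_seqs_def)

lemma c00_subset: "c00 \<subseteq> schreier_seqs"
proof
  fix x :: "nat \<Rightarrow> real" assume x: "x \<in> c00"
  show "x \<in> schreier_seqs"
  proof (rule schreier_seqsI)
    show "x 0 = 0" using x by (simp add: c00_def)
  next
    fix e :: real assume "e > 0"
    then show "\<exists>y\<in>c00. \<forall>F. admissible F \<longrightarrow> (\<Sum>i\<in>F. \<bar>x i - y i\<bar>) \<le> e"
      by (intro bexI[OF _ x]) simp
  qed
qed

lemma zero_in_schreier_seqs: "(\<lambda>_. 0) \<in> schreier_seqs"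
  using c00_subset by (auto simp: c00_def)

typedef schreier = schreier_seqs
  morphisms coord Abs_schreier
  using zero_in_schreier_seqs by blast

setup_lifting type_definition_schreier

lemma coord_0 [simp]: "coord x 0 = 0"
  using coord[of x] by (simp add: schreier_seqs_def)

lemma coord_approx:
  "e > 0 \<Longrightarrow> \<exists>y\<in>c00. \<forall>F. admissible F \<longrightarrow> (\<Sum>i\<in>F. \<bar>coord x i - y i\<bar>) \<le> e"
  by (rule schreier_seqs_approx[OF coord])

lemma admissible_empty [simp]: "admissible {}"
  by (simp add: admissible_def)

lemma admissible_singleton: "i \<ge> 1 \<Longrightarrow> admissible {i}"
  by (simp add: admissible_def)

lemma c00_add: "x \<in> c00 \<Longrightarrow> y \<in> c00 \<Longrightarrow> (\<lambda>i. x i + y i) \<in> c00"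
  unfolding c00_def
  by (auto intro: finite_subset[of _ "{i. x i \<noteq> 0} \<union> {i. y i \<noteq> 0}"])

lemma c00_scale: "x \<in> c00 \<Longrightarrow> (\<lambda>i. r * x i) \<in> c00"
  unfolding c00_def by (auto intro: finite_subset[of _ "{i. x i \<noteq> 0}"])

lemma schreier_seqs_add:
  assumes f: "f \<in> schreier_seqs" and g: "g \<in> schreier_seqs"
  shows "(\<lambda>i. f i + g i) \<in> schreier_seqs"
proof (rule schreier_seqsI)
  show "f 0 + g 0 = 0" using f g by (auto simp: schreier_seqs_def)
next
  fix e :: real
  assume "e > 0"
  then have "e / 2 > 0" by simp
  then obtain u v where u: "u \<in> c00" "\<And>F. admissible F \<Longrightarrow> (\<Sum>i\<in>F. \<bar>f i - u i\<bar>) \<le> e / 2"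
    and v: "v \<in> c00" "\<And>F. admissible F \<Longrightarrow> (\<Sum>i\<in>F. \<bar>g i - v i\<bar>) \<le> e / 2"
    using schreier_seqs_approx[OF f] schreier_seqs_approx[OF g] by blast
  have "(\<Sum>i\<in>F. \<bar>(f i + g i) - (u i + v i)\<bar>) \<le> e" if "admissible F" for F
  proof -
    have "(\<Sum>i\<in>F. \<bar>(f i + g i) - (u i + v i)\<bar>) \<le> (\<Sum>i\<in>F. \<bar>f i - u i\<bar> + \<bar>g i - v i\<bar>)"
      by (rule sum_mono) simp
    also have "\<dots> \<le> e" using u(2)[OF that] v(2)[OF that] by (simp add: sum.distrib)
    finally show ?thesis .
  qed
  with c00_add[OF u(1) v(1)]
  show "\<exists>y\<in>c00. \<forall>F. admissible F \<longrightarrow> (\<Sum>i\<in>F. \<bar>(f i + g i) - y i\<bar>) \<le> e"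
    by (intro bexI[of _ "\<lambda>i. u i + v i"]) auto
qed

lemma schreier_seqs_scale:
  assumes f: "f \<in> schreier_seqs"
  shows "(\<lambda>i. r * f i) \<in> schreier_seqs"
proof (rule schreier_seqsI)
  show "r * f 0 = 0" using f by (auto simp: schreier_seqs_def)
next
  fix e :: real
  assume "e > 0"
  then have "e / (\<bar>r\<bar> + 1) > 0" by simp
  then obtain u where u: "u \<in> c00"
    "\<And>F. admissible F \<Longrightarrow> (\<Sum>i\<in>F. \<bar>f i - u i\<bar>) \<le> e / (\<bar>r\<bar> + 1)"
    using schreier_seqs_approx[OF f] by blast
  have "(\<Sum>i\<in>F. \<bar>r * f i - r * u i\<bar>) \<le> e" if "admissible F" for F
  proof -
    have "(\<Sum>i\<in>F. \<bar>r * f i - r * u i\<bar>) = \<bar>r\<bar> * (\<Sum>i\<in>F. \<bar>f i - u i\<bar>)"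
      by (simp add: sum_distrib_left abs_mult flip: right_diff_distrib)
    also have "\<dots> \<le> (\<bar>r\<bar> + 1) * (e / (\<bar>r\<bar> + 1))"
      by (intro mult_mono u that) (auto intro: sum_nonneg)
    also have "\<dots> = e" by simp
    finally show ?thesis .
  qed
  with c00_scale[OF u(1)]
  show "\<exists>y\<in>c00. \<forall>F. admissible F \<longrightarrow> (\<Sum>i\<in>F. \<bar>r * f i - y i\<bar>) \<le> e"
    by (intro bexI[of _ "\<lambda>i. r * u i"]) auto
qed

instantiation schreier :: real_vector
begin

lift_definition zero_schreier :: schreier is "\<lambda>_. 0"
  by (rule zero_in_schreier_seqs)

lift_definition plus_schreier :: "schreier \<Rightarrow> schreier \<Rightarrow> schreier" is "\<lambda>x y i. x i + y i"
  by (rule schreier_seqs_add)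

lift_definition scaleR_schreier :: "real \<Rightarrow> schreier \<Rightarrow> schreier" is "\<lambda>r x i. r * x i"
  by (rule schreier_seqs_scale)

lift_definition uminus_schreier :: "schreier \<Rightarrow> schreier" is "\<lambda>x i. - x i"
  using schreier_seqs_scale[where r = "- 1"] by simp

lift_definition minus_schreier :: "schreier \<Rightarrow> schreier \<Rightarrow> schreier" is "\<lambda>x y i. x i - y i"
  using schreier_seqs_add[OF _ schreier_seqs_scale[where r = "- 1"]] by simp

instance
  by standard (transfer, simp add: algebra_simps)+

end

lemma coord_zero [simp]: "coord 0 i = 0"
  by (simp add: zero_schreier.rep_eq)

lemma coord_add [simp]: "coord (x + y) i = coord x i + coord y i"
  by (simp add: plus_schreier.rep_eq)

lemma coord_scaleR [simp]: "coord (r *\<^sub>R x) i = r * coord x i"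
  by (simp add: scaleR_schreier.rep_eq)

lemma coord_uminus [simp]: "coord (- x) i = - coord x i"
  by (simp add: uminus_schreier.rep_eq)

lemma coord_diff [simp]: "coord (x - y) i = coord x i - coord y i"
  by (simp add: minus_schreier.rep_eq)

lemma schreier_eqI: "(\<And>i. i \<ge> 1 \<Longrightarrow> coord x i = coord y i) \<Longrightarrow> x = y"
  unfolding coord_inject[symmetric]
proof
  fix i assume *: "\<And>i. i \<ge> 1 \<Longrightarrow> coord x i = coord y i"
  show "coord x i = coord y i" using *[of i] by (cases "i = 0") auto
qed

lemma bdd_above_schreier: "bdd_above ((\<lambda>F. \<Sum>i\<in>F. \<bar>coord x i\<bar>) ` Collect admissible)"
proof -
  obtain y where y: "y \<in> c00" "\<And>F. admissible F \<Longrightarrow> (\<Sum>i\<in>F. \<bar>coord x i - y i\<bar>) \<le> 1"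
    using coord_approx[of 1 x] by auto
  have fin: "finite {i. y i \<noteq> 0}" using y(1) by (simp add: c00_def)
  have "(\<Sum>i\<in>F. \<bar>coord x i\<bar>) \<le> 1 + (\<Sum>i | y i \<noteq> 0. \<bar>y i\<bar>)" if F: "admissible F" for F
  proof -
    have finF: "finite F" using F by (simp add: admissible_def)
    have "(\<Sum>i\<in>F. \<bar>coord x i\<bar>) \<le> (\<Sum>i\<in>F. \<bar>coord x i - y i\<bar> + \<bar>y i\<bar>)"
      by (rule sum_mono) simp
    also have "\<dots> = (\<Sum>i\<in>F. \<bar>coord x i - y i\<bar>) + (\<Sum>i\<in>F. \<bar>y i\<bar>)"
      by (rule sum.distrib)
    also have "(\<Sum>i\<in>F. \<bar>y i\<bar>) = (\<Sum>i\<in>F \<inter> {i. y i \<noteq> 0}. \<bar>y i\<bar>)"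
      using finF by (intro sum.mono_neutral_right) auto
    also have "\<dots> \<le> (\<Sum>i | y i \<noteq> 0. \<bar>y i\<bar>)"
      using fin by (intro sum_mono2) auto
    finally show ?thesis using y(2)[OF F] by simp
  qed
  then show ?thesis by (intro bdd_aboveI2) auto
qed

instantiation schreier :: real_normed_vector
begin

definition norm_schreier :: "schreier \<Rightarrow> real" where
  "norm_schreier x = (SUP F\<in>Collect admissible. \<Sum>i\<in>F. \<bar>coord x i\<bar>)"

definition dist_schreier :: "schreier \<Rightarrow> schreier \<Rightarrow> real" where
  "dist_schreier x y = norm (x - y)"

definition sgn_schreier :: "schreier \<Rightarrow> schreier" where
  "sgn_schreier x = x /\<^sub>R norm x"

definition uniformity_schreier :: "(schreier \<times> schreier) filter" where
  "uniformity_schreier = (INF e\<in>{0 <..}. principal {(x, y). dist x y < e})"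

definition open_schreier :: "schreier set \<Rightarrow> bool" where
  "open_schreier S \<longleftrightarrow> (\<forall>x\<in>S. \<forall>\<^sub>F (x', y) in uniformity. x' = x \<longrightarrow> y \<in> S)"

lemma sum_le_norm_schreier: "admissible F \<Longrightarrow> (\<Sum>i\<in>F. \<bar>coord x i\<bar>) \<le> norm x"
  unfolding norm_schreier_def by (intro cSUP_upper bdd_above_schreier) auto

lemma norm_schreier_leI:
  "(\<And>F. admissible F \<Longrightarrow> (\<Sum>i\<in>F. \<bar>coord x i\<bar>) \<le> b) \<Longrightarrow> norm (x :: schreier) \<le> b"
  unfolding norm_schreier_def by (intro cSUP_least) (auto intro: admissible_empty)

lemma coord_le_norm: "\<bar>coord x i\<bar> \<le> norm x"
proof (cases "i = 0")
  case True
  then show ?thesis using sum_le_norm_schreier[of "{}" x] by simp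
next
  case False
  then show ?thesis using sum_le_norm_schreier[of "{i}" x] admissible_singleton[of i] by simp
qed

instance
proof
  fix x y :: schreier and r :: real
  show "dist x y = norm (x - y)" by (rule dist_schreier_def)
  show "sgn x = x /\<^sub>R norm x" by (rule sgn_schreier_def)
  show "uniformity = (INF e\<in>{0 <..}. principal {(x :: schreier, y). dist x y < e})"
    by (rule uniformity_schreier_def)
  show "open U \<longleftrightarrow> (\<forall>x\<in>U. \<forall>\<^sub>F (x', y) in uniformity. x' = x \<longrightarrow> y \<in> U)" for U :: "schreier set"
    by (rule open_schreier_def)
  show "norm x = 0 \<longleftrightarrow> x = 0"
  proof
    assume "norm x = 0"
    then show "x = 0" using coord_le_norm[of x] by (intro schreier_eqI) simp
  next
    assume "x = 0"
    then show "norm x = 0"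
      using norm_schreier_leI[of 0 0] coord_le_norm[of 0 0] by simp
  qed
  show "norm (x + y) \<le> norm x + norm y"
  proof (rule norm_schreier_leI)
    fix F assume F: "admissible F"
    have "(\<Sum>i\<in>F. \<bar>coord (x + y) i\<bar>) \<le> (\<Sum>i\<in>F. \<bar>coord x i\<bar> + \<bar>coord y i\<bar>)"
      by (rule sum_mono) simp
    then show "(\<Sum>i\<in>F. \<bar>coord (x + y) i\<bar>) \<le> norm x + norm y"
      using sum_le_norm_schreier[OF F, of x] sum_le_norm_schreier[OF F, of y]
      by (simp add: sum.distrib)
  qed
  have le: "norm (s *\<^sub>R z) \<le> \<bar>s\<bar> * norm z" for s :: real and z :: schreier
    by (rule norm_schreier_leI)
      (auto simp: abs_mult intro!: mult_left_mono sum_le_norm_schreier simp flip: sum_distrib_left)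
  show "norm (r *\<^sub>R x) = \<bar>r\<bar> * norm x"
  proof (cases "r = 0")
    case True
    then show ?thesis
      using norm_schreier_leI[of 0 0] coord_le_norm[of 0 0] by simp
  next
    case False
    have "norm x = norm ((1 / r) *\<^sub>R (r *\<^sub>R x))" using False by simp
    also have "\<dots> \<le> \<bar>1 / r\<bar> * norm (r *\<^sub>R x)" by (rule le)
    finally have "\<bar>r\<bar> * norm x \<le> norm (r *\<^sub>R x)"
      using False by (simp add: field_simps)
    with le[of r x] show ?thesis by simp
  qed
qed

end

lemma norm_schreier_eq: "norm x = (SUP F\<in>Collect admissible. \<Sum>i\<in>F. \<bar>coord x i\<bar>)"
  by (rule norm_schreier_def)

instance schreier :: banach
proof
  fix X :: "nat \<Rightarrow> schreier"
  assume C: "Cauchy X"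
  have "Cauchy (\<lambda>n. coord (X n) i)" for i
  proof (rule metric_CauchyI)
    fix e :: real assume "e > 0"
    then obtain M where M: "\<forall>m\<ge>M. \<forall>n\<ge>M. dist (X m) (X n) < e"
      using metric_CauchyD[OF C] by blast
    have "dist (coord (X m) i) (coord (X n) i) < e" if "m \<ge> M" "n \<ge> M" for m n
    proof -
      have "dist (coord (X m) i) (coord (X n) i) \<le> dist (X m) (X n)"
        using coord_le_norm[of "X m - X n" i] by (simp add: dist_norm)
      also have "\<dots> < e" using M that by blast
      finally show ?thesis .
    qed
    then show "\<exists>M. \<forall>m\<ge>M. \<forall>n\<ge>M. dist (coord (X m) i) (coord (X n) i) < e"
      by blast
  qed
  then obtain z where z: "\<And>i. (\<lambda>n. coord (X n) i) \<longlonglongrightarrow> z i"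
    unfolding Cauchy_convergent_iff convergent_def by metis
  have key: "\<exists>M. \<forall>m\<ge>M. \<forall>F. admissible F \<longrightarrow> (\<Sum>i\<in>F. \<bar>coord (X m) i - z i\<bar>) \<le> e"
    if "e > 0" for e
  proof -
    obtain M where M: "\<And>m n. m \<ge> M \<Longrightarrow> n \<ge> M \<Longrightarrow> norm (X m - X n) < e"
      using metric_CauchyD[OF C \<open>e > 0\<close>] unfolding dist_norm by blast
    have "(\<Sum>i\<in>F. \<bar>coord (X m) i - z i\<bar>) \<le> e" if m: "m \<ge> M" and F: "admissible F" for m F
    proof (rule LIMSEQ_le_const2)
      show "(\<lambda>n. \<Sum>i\<in>F. \<bar>coord (X m) i - coord (X n) i\<bar>) \<longlonglongrightarrow> (\<Sum>i\<in>F. \<bar>coord (X m) i - z i\<bar>)"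
        by (intro tendsto_intros z)
      show "\<exists>N. \<forall>n\<ge>N. (\<Sum>i\<in>F. \<bar>coord (X m) i - coord (X n) i\<bar>) \<le> e"
      proof (intro exI allI impI)
        fix n assume "n \<ge> M"
        then show "(\<Sum>i\<in>F. \<bar>coord (X m) i - coord (X n) i\<bar>) \<le> e"
          using sum_le_norm_schreier[OF F, of "X m - X n"] M[OF m, of n] by simp
      qed
    qed
    then show ?thesis by blast
  qed
  have "(\<lambda>n. coord (X n) 0) \<longlonglongrightarrow> 0" by simp
  then have z0: "z 0 = 0" using LIMSEQ_unique[OF z] by blast
  have "\<exists>y\<in>c00. \<forall>F. admissible F \<longrightarrow> (\<Sum>i\<in>F. \<bar>z i - y i\<bar>) \<le> e" if "e > 0" for e
  proof -
    have "e / 2 > 0" using that by simp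
    obtain m where m: "\<And>F. admissible F \<Longrightarrow> (\<Sum>i\<in>F. \<bar>coord (X m) i - z i\<bar>) \<le> e / 2"
      using key[OF \<open>e / 2 > 0\<close>] by blast
    obtain y where y: "y \<in> c00" "\<And>F. admissible F \<Longrightarrow> (\<Sum>i\<in>F. \<bar>coord (X m) i - y i\<bar>) \<le> e / 2"
      using coord_approx[OF \<open>e / 2 > 0\<close>] by blast
    have "(\<Sum>i\<in>F. \<bar>z i - y i\<bar>) \<le> e" if "admissible F" for F
    proof -
      have "(\<Sum>i\<in>F. \<bar>z i - y i\<bar>) \<le> (\<Sum>i\<in>F. \<bar>coord (X m) i - z i\<bar> + \<bar>coord (X m) i - y i\<bar>)"
        by (rule sum_mono) simp
      also have "\<dots> \<le> e" using m[OF that] y(2)[OF that] by (simp add: sum.distrib)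
      finally show ?thesis .
    qed
    with y(1) show ?thesis by blast
  qed
  with z0 have Z: "coord (Abs_schreier z) = z"
    by (intro Abs_schreier_inverse schreier_seqsI)
  have "X \<longlonglongrightarrow> Abs_schreier z"
  proof (rule metric_LIMSEQ_I)
    fix e :: real assume "e > 0"
    then have "e / 2 > 0" by simp
    obtain M where M: "\<And>m F. m \<ge> M \<Longrightarrow> admissible F \<Longrightarrow> (\<Sum>i\<in>F. \<bar>coord (X m) i - z i\<bar>) \<le> e / 2"
      using key[OF \<open>e / 2 > 0\<close>] by blast
    have "dist (X m) (Abs_schreier z) < e" if "m \<ge> M" for m
    proof -
      have "norm (X m - Abs_schreier z) \<le> e / 2"
        using M[OF that] by (intro norm_schreier_leI) (simp add: Z)
      also have "\<dots> < e" using \<open>e > 0\<close> by simp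
      finally show ?thesis by (simp add: dist_norm)
    qed
    then show "\<exists>M. \<forall>m\<ge>M. dist (X m) (Abs_schreier z) < e" by blast
  qed
  then show "convergent X" by (rule convergentI)
qed

lemma c00_embeds: "y \<in> c00 \<Longrightarrow> coord (Abs_schreier y) = y"
  using c00_subset by (intro Abs_schreier_inverse) blast

lemma c00_dense: "closure (Abs_schreier ` c00) = UNIV"
proof (intro equalityI subsetI UNIV_I)
  fix x :: schreier
  show "x \<in> closure (Abs_schreier ` c00)"
    unfolding closure_approachable
  proof (intro allI impI)
    fix e :: real assume "e > 0"
    then have "e / 2 > 0" by simp
    obtain y where y: "y \<in> c00" "\<And>F. admissible F \<Longrightarrow> (\<Sum>i\<in>F. \<bar>coord x i - y i\<bar>) \<le> e / 2"
      using coord_approx[OF \<open>e / 2 > 0\<close>] by blast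
    have "norm (x - Abs_schreier y) \<le> e / 2"
      using y by (intro norm_schreier_leI) (simp add: c00_embeds)
    then have "dist (Abs_schreier y) x < e"
      using \<open>e > 0\<close> by (simp add: dist_norm norm_minus_commute)
    with y(1) show "\<exists>y\<in>Abs_schreier ` c00. dist y x < e" by blast
  qed
qed

definition supp :: "schreier \<Rightarrow> nat set" where
  "supp x = {i. coord x i \<noteq> 0}"

definition one_set :: "schreier \<Rightarrow> nat set \<Rightarrow> bool" where
  "one_set x F \<longleftrightarrow> admissible F \<and> (\<Sum>i\<in>F. \<bar>coord x i\<bar>) = 1 \<and> (\<forall>i\<in>F. \<bar>coord x i\<bar> > 0)"

definition non_maximal :: "nat set \<Rightarrow> bool" where
  "non_maximal F \<longleftrightarrow> admissible F \<and> (\<exists>j. j \<notin> F \<and> admissible (F \<union> {j}))"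

definition non_maximal_one_set :: "schreier \<Rightarrow> nat set \<Rightarrow> bool" where
  "non_maximal_one_set x F \<longleftrightarrow> one_set x F \<and> non_maximal F"

end

(* Perturbing a single coordinate of an extreme point x must leave the unit ball, so every index
   lies in an admissible set that almost norms x. This forces finite support; then every index
   lies in an admissible set of sum exactly 1. If k lies outside the support, intersecting such a
   set with the support gives a non-maximal 1-set H that k extends, so |H| < k; an index k beyond
   the support yields existence. Conversely a non-maximal 1-set F contains every element of the
   support beyond |F|, since it could absorb such an element. Hence an index k <= |F| outside the
   support would give a non-maximal 1-set H with |H| < |F| but F contained in H. So the support is
   the disjoint union of {1, ..., |F|} and F. *)

theory Submission
  imports Defs
begin

lemma admissible_iff: "admissible F \<longleftrightarrow> finite F \<and> (\<forall>i\<in>F. card F \<le> i)"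
proof
  assume "admissible F"
  then show "finite F \<and> (\<forall>i\<in>F. card F \<le> i)"
    unfolding admissible_def by (metis Min_le empty_iff le_trans)
next
  assume *: "finite F \<and> (\<forall>i\<in>F. card F \<le> i)"
  have "1 \<le> i" if "i \<in> F" for i
  proof -
    have "card F \<noteq> 0" using * that by auto
    with * that show ?thesis by (metis One_nat_def Suc_leI gr0I le_zero_eq)
  qed
  with * show "admissible F"
    unfolding admissible_def by (auto intro: Min.boundedI)
qed

lemma admissible_mono: "admissible F \<Longrightarrow> G \<subseteq> F \<Longrightarrow> admissible G"
  unfolding admissible_iff by (meson card_mono finite_subset le_trans subsetD)

lemma supp_pos: "i \<in> supp x \<Longrightarrow> 1 \<le> i"
  using coord_0[of x] by (cases i) (auto simp: supp_def)

lemma sum_abs_coord_supp: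
  assumes "finite G"
  shows "(\<Sum>i\<in>G \<inter> supp x. \<bar>coord x i\<bar>) = (\<Sum>i\<in>G. \<bar>coord x i\<bar>)"
  using assms by (intro sum.mono_neutral_left) (auto simp: supp_def)

text \<open>Beyond the support of a finitely supported approximant \<open>y\<close> the sequences
  \<open>x\<close> and \<open>x - y\<close> agree, and admissible sums of the latter are at most
  \<open>e\<close>.\<close>

lemma schreier_tail_small:
  assumes "e > 0"
  obtains N where "\<And>F. admissible F \<Longrightarrow> F \<subseteq> {N..} \<Longrightarrow> (\<Sum>i\<in>F. \<bar>coord x i\<bar>) \<le> e"
proof -
  obtain y where y: "y \<in> c00" "\<And>F. admissible F \<Longrightarrow> (\<Sum>i\<in>F. \<bar>coord x i - y i\<bar>) \<le> e"
    using coord_approx[OF assms] by blast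
  have "finite {i. y i \<noteq> 0}" using y(1) by (simp add: c00_def)
  then obtain N where N: "\<And>i. y i \<noteq> 0 \<Longrightarrow> i < N"
    by (metis (mono_tags) finite_nat_set_iff_bounded mem_Collect_eq)
  show ?thesis
  proof (rule that)
    fix F assume F: "admissible F" "F \<subseteq> {N..}"
    have "(\<Sum>i\<in>F. \<bar>coord x i\<bar>) = (\<Sum>i\<in>F. \<bar>coord x i - y i\<bar>)"
    proof (rule sum.cong)
      fix i assume "i \<in> F"
      then have "y i = 0" using F(2) N[of i] by fastforce
      then show "\<bar>coord x i\<bar> = \<bar>coord x i - y i\<bar>" by simp
    qed simp
    with y(2)[OF F(1)] show "(\<Sum>i\<in>F. \<bar>coord x i\<bar>) \<le> e" by simp
  qed
qed

lemma extreme_point_sum_le: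
  assumes "x extreme_point_of cball (0 :: schreier) 1" "admissible F"
  shows "(\<Sum>i\<in>F. \<bar>coord x i\<bar>) \<le> 1"
  using sum_le_norm_schreier[OF assms(2), of x] assms(1) by (simp add: extreme_point_of_def)

text \<open>Otherwise every admissible set through \<open>i\<close> has slack \<open>e\<close>.
  Moving coordinate \<open>i\<close> by \<open>e\<close> either way then stays in the ball and
  exhibits \<open>x\<close> as a proper midpoint.\<close>

lemma extreme_point_almost_normed:
  assumes x: "x extreme_point_of cball (0 :: schreier) 1" and i: "i \<ge> 1" and e: "e > 0"
  obtains G where "admissible G" "i \<in> G" "(\<Sum>j\<in>G. \<bar>coord x j\<bar>) > 1 - e"
proof (rule ccontr)
  assume "\<not> thesis"
  with that have small: "\<And>G. admissible G \<Longrightarrow> i \<in> G \<Longrightarrow> (\<Sum>j\<in>G. \<bar>coord x j\<bar>) \<le> 1 - e"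
    by (meson not_le)
  define y where "y = Abs_schreier (\<lambda>j. if j = i then e else 0)"
  have y: "coord y = (\<lambda>j. if j = i then e else 0)"
    unfolding y_def using i by (intro c00_embeds) (auto simp: c00_def)
  have ball: "norm (x + r *\<^sub>R y) \<le> 1" if r: "\<bar>r\<bar> = 1" for r
  proof (rule norm_schreier_leI)
    fix F assume F: "admissible F"
    then have fin: "finite F" by (simp add: admissible_iff)
    have "(\<Sum>j\<in>F. \<bar>coord (x + r *\<^sub>R y) j\<bar>) \<le> (\<Sum>j\<in>F. \<bar>coord x j\<bar> + (if j = i then e else 0))"
      using r e by (intro sum_mono) (auto simp: y abs_mult intro: order_trans[OF abs_triangle_ineq])
    also have "\<dots> = (\<Sum>j\<in>F. \<bar>coord x j\<bar>) + (if i \<in> F then e else 0)"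
      using fin by (simp add: sum.distrib)
    \<comment> \<open>Sets through \<open>i\<close> have slack \<open>e\<close> by
      \<open>small\<close>; all other sets do not see the perturbation.\<close>
    also have "\<dots> \<le> 1"
      using small[OF F] extreme_point_sum_le[OF x F] by auto
    finally show "(\<Sum>j\<in>F. \<bar>coord (x + r *\<^sub>R y) j\<bar>) \<le> 1" .
  qed
  have "x + y \<noteq> x - y"
  proof
    assume "x + y = x - y"
    then have "coord (x + y) i = coord (x - y) i" by (rule arg_cong)
    with e show False by (simp add: y)
  qed
  moreover have "x = midpoint (x + y) (x - y)"
    by (simp add: midpoint_def flip: scaleR_2)
  ultimately have "x \<in> open_segment (x + y) (x - y)"
    by (metis midpoint_in_open_segment)
  moreover have "x + y \<in> cball 0 1" "x - y \<in> cball 0 1"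
    using ball[of 1] ball[of "-1"] by auto
  ultimately show False
    using x by (auto simp: extreme_point_of_def)
qed

text \<open>An exchange argument: in an admissible set that almost norms \<open>x\<close> and passes
  through an index with tiny coordinate, that index is traded for a support element with a large
  coordinate, which pushes the sum above 1.\<close>

lemma extreme_point_finite_supp:
  assumes x: "x extreme_point_of cball (0 :: schreier) 1"
  shows "finite (supp x)"
proof (rule ccontr)
  assume inf: "infinite (supp x)"
  obtain N where N: "\<And>F. admissible F \<Longrightarrow> F \<subseteq> {N..} \<Longrightarrow> (\<Sum>i\<in>F. \<bar>coord x i\<bar>) \<le> 1/4"
    using schreier_tail_small[of "1/4" x] by auto
  have "supp x - {..<N} = supp x \<inter> {N..}" by auto
  then have "infinite (supp x \<inter> {N..})"
    using inf by (metis Diff_infinite_finite finite_lessThan)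
  \<comment> \<open>An admissible set with an element below \<open>N\<close> has fewer than
    \<open>N\<close> elements, so it misses some element of \<open>T\<close>.\<close>
  then obtain T where T: "finite T" "card T = Suc N" "T \<subseteq> supp x \<inter> {N..}"
    using infinite_arbitrarily_large by blast
  then have "T \<noteq> {}" by auto
  define h where "h = Min ((\<lambda>j. \<bar>coord x j\<bar>) ` T)"
  have h: "\<bar>coord x j\<bar> \<ge> h" if "j \<in> T" for j
    unfolding h_def using T(1) that by simp
  have "h > 0"
    unfolding h_def using T \<open>T \<noteq> {}\<close> by (auto simp: supp_def)
  obtain M where M: "\<And>F. admissible F \<Longrightarrow> F \<subseteq> {M..} \<Longrightarrow> (\<Sum>i\<in>F. \<bar>coord x i\<bar>) \<le> h/4"
    using schreier_tail_small[of "h/4" x] \<open>h > 0\<close> by auto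
  define i where "i = max 1 (max M N)"
  have ai: "\<bar>coord x i\<bar> \<le> h/4"
    using M[of "{i}"] by (auto simp: i_def admissible_iff)
  \<comment> \<open>The bound 1/2 makes the sum exceed 1/4, so \<open>G\<close> must start below
    \<open>N\<close>. The bound \<open>h/2\<close> is less than the gain of the exchange, at least
    \<open>h - h/4\<close>.\<close>
  obtain G where G: "admissible G" "i \<in> G" "(\<Sum>j\<in>G. \<bar>coord x j\<bar>) > 1 - min (h/2) (1/2)"
    using extreme_point_almost_normed[OF x, of i "min (h/2) (1/2)"] \<open>h > 0\<close>
    by (auto simp: i_def)
  have "\<not> G \<subseteq> {N..}"
    using N[OF G(1)] G(3) by auto
  then obtain k where k: "k \<in> G" "k < N" by (auto simp: subset_iff not_le)
  have finG: "finite G" and cardG: "\<And>l. l \<in> G \<Longrightarrow> card G \<le> l"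
    using G(1) by (auto simp: admissible_iff)
  have "card G < card T" using cardG[OF k(1)] k(2) T(2) by simp
  then obtain j where j: "j \<in> T" "j \<notin> G"
    using finG by (metis card_mono not_le subsetI)
  \<comment> \<open>The exchange keeps the cardinality, and the new element \<open>j\<close> is at
    least \<open>N\<close>, hence above \<open>card G\<close>.\<close>
  let ?G = "insert j (G - {i})"
  have "card ?G = card G"
    using card_Suc_Diff1[OF finG G(2)] finG j(2) by (simp del: card_Diff_insert)
  moreover have "card G \<le> j" using cardG[OF k(1)] k(2) T(3) j(1) by auto
  ultimately have "admissible ?G"
    unfolding admissible_iff using finG cardG by auto
  then have "(\<Sum>l\<in>?G. \<bar>coord x l\<bar>) \<le> 1" by (rule extreme_point_sum_le[OF x])
  moreover have "(\<Sum>l\<in>?G. \<bar>coord x l\<bar>) = \<bar>coord x j\<bar> + ((\<Sum>l\<in>G. \<bar>coord x l\<bar>) - \<bar>coord x i\<bar>)"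
    using finG j(2) G(2) by (simp add: sum_diff1)
  ultimately show False using h[OF j(1)] ai G(3) \<open>h > 0\<close> by linarith
qed

text \<open>Finite support leaves only finitely many values for the sums, so a sum close enough to 1
  equals 1.\<close>

lemma extreme_point_normed:
  assumes x: "x extreme_point_of cball (0 :: schreier) 1" and i: "i \<ge> 1"
  obtains G where "admissible G" "i \<in> G" "(\<Sum>j\<in>G. \<bar>coord x j\<bar>) = 1"
proof -
  \<comment> \<open>The possible sums below 1; the explicit 0 makes it immediate that
    \<open>Max V\<close> is a genuine maximum. The gap \<open>1 - Max V\<close> serves as tolerance
    below.\<close>
  define V where "V = insert 0 {v \<in> (\<lambda>A. \<Sum>j\<in>A. \<bar>coord x j\<bar>) ` Pow (supp x). v < 1}"
  have fin: "finite V"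
    unfolding V_def using extreme_point_finite_supp[OF x] by simp
  have "Max V \<in> V" using fin by (intro Max_in) (auto simp: V_def)
  then have "Max V < 1" by (auto simp: V_def)
  then obtain G where G: "admissible G" "i \<in> G" "(\<Sum>j\<in>G. \<bar>coord x j\<bar>) > Max V"
    using extreme_point_almost_normed[OF x i, of "1 - Max V"] by auto
  have "(\<Sum>j\<in>G. \<bar>coord x j\<bar>) = (\<Sum>j\<in>G \<inter> supp x. \<bar>coord x j\<bar>)"
    using G(1) by (intro sum_abs_coord_supp[symmetric]) (simp add: admissible_iff)
  then have "(\<Sum>j\<in>G. \<bar>coord x j\<bar>) \<in> V" if "(\<Sum>j\<in>G. \<bar>coord x j\<bar>) < 1"
    using that by (auto simp: V_def)
  with G(3) Max_ge[OF fin] have "\<not> (\<Sum>j\<in>G. \<bar>coord x j\<bar>) < 1" by (meson not_le)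
  with extreme_point_sum_le[OF x G(1)] that[OF G(1,2)] show ?thesis by linarith
qed

text \<open>Discarding the zeros of \<open>x\<close> from a norming set through \<open>k\<close>
  discards \<open>k\<close> itself. That \<open>k\<close> can be put back gives both non-maximality
  and \<open>card H + 1 \<le> k\<close>.\<close>

lemma non_maximal_one_set_avoiding:
  assumes x: "x extreme_point_of cball (0 :: schreier) 1" and k: "k \<ge> 1" "k \<notin> supp x"
  obtains H where "non_maximal_one_set x H" "card H < k"
proof -
  obtain G where G: "admissible G" "k \<in> G" "(\<Sum>j\<in>G. \<bar>coord x j\<bar>) = 1"
    using extreme_point_normed[OF x k(1)] .
  let ?H = "G \<inter> supp x"
  have finG: "finite G" using G(1) by (simp add: admissible_iff)
  have adm: "admissible ?H" "admissible (?H \<union> {k})"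
    using G(1,2) by (auto intro: admissible_mono)
  show ?thesis
  proof (rule that)
    have "one_set x ?H"
      unfolding one_set_def using adm(1) G(3) sum_abs_coord_supp[OF finG, of x]
      by (simp add: supp_def)
    moreover have "non_maximal ?H"
      unfolding non_maximal_def using adm k(2) by blast
    ultimately show "non_maximal_one_set x ?H" by (simp add: non_maximal_one_set_def)
    show "card ?H < k"
      using adm(2) k(2) finG by (simp add: admissible_iff)
  qed
qed

lemma non_maximal_one_set_eq:
  assumes x: "x extreme_point_of cball (0 :: schreier) 1" and F: "non_maximal_one_set x F"
  shows "F = supp x \<inter> {card F<..}"
proof
  have adm: "admissible F" and sum1: "(\<Sum>i\<in>F. \<bar>coord x i\<bar>) = 1"
    and pos: "\<And>i. i \<in> F \<Longrightarrow> \<bar>coord x i\<bar> > 0"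
    using F by (auto simp: non_maximal_one_set_def one_set_def)
  have fin: "finite F" using adm by (simp add: admissible_iff)
  obtain j where j: "j \<notin> F" "admissible (F \<union> {j})"
    using F by (auto simp: non_maximal_one_set_def non_maximal_def)
  \<comment> \<open>The admissible set \<open>F \<union> {j}\<close> has \<open>card F + 1\<close>
    elements, which bounds each of its members from below.\<close>
  then have gt: "card F < i" if "i \<in> F" for i
    using that fin by (auto simp: admissible_iff Suc_le_eq)
  with pos show "F \<subseteq> supp x \<inter> {card F<..}" by (auto simp: supp_def)
  show "supp x \<inter> {card F<..} \<subseteq> F"
  proof (rule subsetI, rule ccontr)
    fix i assume i: "i \<in> supp x \<inter> {card F<..}" "i \<notin> F"
    then have "admissible (insert i F)"
      using fin gt by (auto simp: admissible_iff Suc_le_eq)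
    from extreme_point_sum_le[OF x this] sum1 i fin show False
      by (simp add: supp_def)
  qed
qed

lemma card_supp_extreme_point:
  assumes x: "x extreme_point_of cball (0 :: schreier) 1" and F: "non_maximal_one_set x F"
  shows "card (supp x) = 2 * card F"
proof -
  have fin: "finite F"
    using F by (simp add: non_maximal_one_set_def one_set_def admissible_def)
  have F_eq: "F = supp x \<inter> {card F<..}" by (rule non_maximal_one_set_eq[OF x F])
  have "{1..card F} \<subseteq> supp x"
  proof (rule subsetI, rule ccontr)
    fix k assume k: "k \<in> {1..card F}" "k \<notin> supp x"
    then obtain H where H: "non_maximal_one_set x H" "card H < k"
      using non_maximal_one_set_avoiding[OF x] by auto
    have "finite H"
      using H(1) by (simp add: non_maximal_one_set_def one_set_def admissible_def)
    \<comment> \<open>Both sets are tails of the support, and \<open>H\<close> has the smaller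
      threshold.\<close>
    moreover have "F \<subseteq> H"
    proof
      fix j assume "j \<in> F"
      then have "j \<in> supp x \<inter> {card F<..}" by (subst (asm) F_eq)
      then have "j \<in> supp x \<inter> {card H<..}" using H(2) k(1) by simp
      then show "j \<in> H" using non_maximal_one_set_eq[OF x H(1)] by blast
    qed
    ultimately have "card F \<le> card H" by (rule card_mono)
    with H(2) k(1) show False by simp
  qed
  then have "supp x = {1..card F} \<union> (supp x \<inter> {card F<..})"
    using supp_pos[of _ x] by force
  also have "supp x \<inter> {card F<..} = F" by (rule F_eq[symmetric])
  finally have "supp x = {1..card F} \<union> F" .
  moreover have "{1..card F} \<inter> F = {}" by (subst (2) F_eq) auto
  ultimately show ?thesis using fin by (simp add: card_Un_disjoint)
qed

lemma extreme_point_has_non_maximal_one_set: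
  assumes x: "x extreme_point_of cball (0 :: schreier) 1"
  obtains F where "non_maximal_one_set x F"
proof -
  \<comment> \<open>Adjoining the dummy index 0 forces the fresh index \<open>k\<close> to be
    positive.\<close>
  have "finite (insert 0 (supp x))" using extreme_point_finite_supp[OF x] by simp
  then obtain k where "k \<notin> insert 0 (supp x)" using ex_new_if_finite[OF infinite_UNIV_nat] by blast
  then have "k \<ge> 1" "k \<notin> supp x" by auto
  then obtain H where "non_maximal_one_set x H"
    using non_maximal_one_set_avoiding[OF x] by metis
  then show thesis by (rule that)
qed

theorem mainTheorem3:
  shows "(\<forall>(x :: schreier) F. x extreme_point_of cball 0 1 \<and> non_maximal_one_set x F \<longrightarrow>
            finite (supp x) \<and> real (card F) = 1 / 2 * real (card (supp x))) \<and>
         (\<forall>x :: schreier. x extreme_point_of cball 0 1 \<longrightarrow>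
            finite (supp x) \<and> even (card (supp x)))"
proof (intro conjI allI impI; (elim conjE)?)
  fix x :: schreier assume x: "x extreme_point_of cball 0 1"
  show "finite (supp x)" by (rule extreme_point_finite_supp[OF x])
  then show "finite (supp x)" .
  obtain F where "non_maximal_one_set x F" by (rule extreme_point_has_non_maximal_one_set[OF x])
  from card_supp_extreme_point[OF x this] show "even (card (supp x))" by simp
  fix F assume "non_maximal_one_set x F"
  from card_supp_extreme_point[OF x this]
  show "real (card F) = 1 / 2 * real (card (supp x))" by simp
qed

end
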